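(* Let $F$ be a proper $3$-graph, let $A\subseteq V(F)$, and let $\varepsilon>0$. Then there is $n_0\in\mathbb N$ such that the following holds. If $H$ is a simplicial complex on $n\ge n_0$ vertices satisfying $$\frac{e^3 n^{n-2}}{(n+3)^n}\big[\mathrm{ex}^{(3)}(n,F)+n^2\big]\ \ge\ \Big[\frac{|A|-1}{|A|}+\frac1n\cdot\frac{v(F)-|A|}{|A|}\Big]\Big[1+\sum_{i\ge 2}\frac{\Delta^{(i+1)}}{i}\Big],$$ where $\Delta^{(i)}=\max_{\{x,y\}\subseteq V(H),x\ne y} d^{(i)}(xy)$, and $e(H)\ge(1+\varepsilon)\big[\mathrm{ex}^{(3)}(n,F)+\binom n2\big]$, then $H$ contains a copy of $F^+$ provided that either (1) $H$ contains no edge of size $4$, or (2) $F$ is contained in a $4$-edge (i.e., $F$ is a subhypergraph of the complete $3$-graph on $4$ vertices, so that the downward closure of any set of size $4$ contains a copy of $F$).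
   Context: Here $e$ is Euler's number. A simplicial complex is a pair $H=(V,E)$ with $E\subseteq\mathscr P(V)$ closed under taking subsets; all sets in $E$ (including the empty set and singletons) count as edges and $e(H)=|E|$. For a pair $\{x,y\}$ of vertices, $d^{(i)}(xy)$ is the number of edges of size $i$ of $H$ containing both $x$ and $y$. $v(F)$ is the number of vertices of $F$. $H$ contains a copy of a hypergraph or simplicial complex $F'$ if there is an injection $\varphi:V(F')\to V(H)$ with $\varphi(e)\in E(H)$ for all $e\in E(F')$. For a $3$-graph $F$, $\mathrm{ex}^{(3)}(n,F)$ is the maximum number of edges in a $3$-uniform hypergraph on $n$ vertices with no copy of $F$. A $3$-graph $F$ is proper if for every $\varepsilon>0$ there is $n_0$ such that for all $n\ge n_0$, $(1+\varepsilon)[\mathrm{ex}^{(3)}(n,F)-\mathrm{ex}^{(3)}(n-1,F)]\ge \mathrm{ex}^{(3)}(n,F)/n$. For a $3$-graph $F$ and $A\subseteq V(F)$, $F^+$ is the simplicial complex obtained from $F$ by adding a new vertex $a$ and all $2$-edges $\{a,x\}$ for $x\in A$, and then taking the downward closure. *)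

theory Defs
  imports Complex_Main
begin

type_synonym 'a hypergraph = "'a set \<times> 'a set set"

abbreviation verts :: "'a hypergraph \<Rightarrow> 'a set" where
  "verts \<equiv> fst"

abbreviation edges :: "'a hypergraph \<Rightarrow> 'a set set" where
  "edges \<equiv> snd"

definition three_graph :: "'a hypergraph \<Rightarrow> bool" where
  "three_graph G \<longleftrightarrow> finite (verts G) \<and> (\<forall>e\<in>edges G. e \<subseteq> verts G \<and> card e = 3)"

definition simplicial_complex :: "'a hypergraph \<Rightarrow> bool" where
  "simplicial_complex H \<longleftrightarrow>
     finite (verts H) \<and> edges H \<subseteq> Pow (verts H) \<and>
     (\<forall>e\<in>edges H. \<forall>s. s \<subseteq> e \<longrightarrow> s \<in> edges H)"

definition contains_copy :: "'b hypergraph \<Rightarrow> 'a hypergraph \<Rightarrow> bool" where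
  "contains_copy H F \<longleftrightarrow>
     (\<exists>\<phi>. inj_on \<phi> (verts F) \<and> \<phi> ` verts F \<subseteq> verts H \<and> (\<forall>e\<in>edges F. \<phi> ` e \<in> edges H))"

definition complete_three_graph :: "nat \<Rightarrow> nat hypergraph" where
  "complete_three_graph n = ({..<n}, {e. e \<subseteq> {..<n} \<and> card e = 3})"

text \<open>
  The supremum of a finite nonempty set of naturals is its maximum. The set below is empty only
  if \<^term>\<open>F\<close> has no edges and at most \<^term>\<open>n\<close> vertices, in which case the value is \<^term>\<open>0::nat\<close>.
\<close>
definition ex3 :: "nat \<Rightarrow> 'a hypergraph \<Rightarrow> nat" where
  "ex3 n F = Sup {card (edges G) | G :: nat hypergraph.
     three_graph G \<and> verts G = {..<n} \<and> \<not> contains_copy G F}"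

definition turan_proper :: "'a hypergraph \<Rightarrow> bool" where
  "turan_proper F \<longleftrightarrow>
     (\<forall>\<epsilon>>0. \<exists>n0. \<forall>n\<ge>n0.
        (1 + \<epsilon>) * (real (ex3 n F) - real (ex3 (n - 1) F)) \<ge> real (ex3 n F) / real n)"

definition pair_degree :: "'a hypergraph \<Rightarrow> nat \<Rightarrow> 'a \<Rightarrow> 'a \<Rightarrow> nat" where
  "pair_degree H i x y = card {e \<in> edges H. card e = i \<and> x \<in> e \<and> y \<in> e}"

definition max_pair_degree :: "'a hypergraph \<Rightarrow> nat \<Rightarrow> nat" where
  "max_pair_degree H i =
     Max {pair_degree H i x y | x y. x \<in> verts H \<and> y \<in> verts H \<and> x \<noteq> y}"

text \<open>
  By the following fact, a sum of \<^const>\<open>max_pair_degree\<close> over all edge sizes may be truncated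
  at the number of vertices.
\<close>
lemma max_pair_degree_eq_0:
  assumes "simplicial_complex H" and "card (verts H) \<ge> 2" and "i > card (verts H)"
  shows "max_pair_degree H i = 0"
proof -
  have "card e \<le> card (verts H)" if "e \<in> edges H" for e
    using assms(1) that by (auto simp: simplicial_complex_def intro!: card_mono)
  then have no_edge: "{e \<in> edges H. card e = i \<and> x \<in> e \<and> y \<in> e} = {}" for x y
    using assms(3) by fastforce
  have zero: "pair_degree H i x y = 0" for x y
    unfolding pair_degree_def no_edge by simp
  obtain T where "T \<subseteq> verts H" "card T = 2"
    using assms(2) by (meson obtain_subset_with_card_n)
  then obtain x y where "x \<in> verts H" "y \<in> verts H" "x \<noteq> y"
    by (auto simp: card_2_iff)
  then have "{pair_degree H i x y | x y. x \<in> verts H \<and> y \<in> verts H \<and> x \<noteq> y} = {0}"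
    by (auto simp: zero)
  then show ?thesis
    by (simp add: max_pair_degree_def)
qed

definition down_closure :: "'a set set \<Rightarrow> 'a set set" where
  "down_closure S = {s. \<exists>e\<in>S. s \<subseteq> e}"

text \<open>The new vertex is \<^term>\<open>None\<close>; the old vertices are embedded by \<^term>\<open>Some\<close>.\<close>
definition plus_complex :: "'a hypergraph \<Rightarrow> 'a set \<Rightarrow> 'a option hypergraph" where
  "plus_complex F A =
     (insert None (Some ` verts F),
      down_closure ((\<lambda>e. Some ` e) ` edges F \<union> {{None, Some x} | x. x \<in> A}))"

end

theory Submission imports Defs "HOL-Analysis.Convex" begin

text \<open>
  Repeatedly delete a vertex whose degree is so small that it could have too few neighbours. If
  \<open>K = 1 + (\<Sum>i\<ge>2. \<Delta>\<^bsup>(i+1)\<^esup> / i)\<close>, then a vertex with \<open>d\<close> neighbours lies in at most \<open>1 + d * K\<close> edges,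
  so on \<open>j\<close> remaining vertices each deletion costs about \<open>j * (|A| - 1) / |A| * K\<close> edges, which the
  hypothesis bounds by about \<open>j * (ex(n) + n\<^sup>2) / n\<^sup>2\<close>. When \<open>m = x * n\<close> vertices are left, at
  least about \<open>ex(n) * (1 + x\<^sup>2) / 2 + m\<^sup>2 / 2\<close> edges survive, with a surplus of order \<open>\<epsilon>\<close>.
  Properness gives \<open>ex(m) \<le> (x + o(1)) * ex(n)\<close>, and \<open>x \<le> (1 + x\<^sup>2) / 2\<close>, so the remaining
  complex still contains \<open>F\<close>. All its vertices have so many neighbours that the images of the
  vertices in \<open>A\<close> have a common neighbour outside the copy of \<open>F\<close>.
\<close>

section \<open>Induced subcomplexes, degrees and neighbourhoods\<close>

definition induced :: "'a hypergraph \<Rightarrow> 'a set \<Rightarrow> 'a hypergraph" where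
  "induced H W = (W, {e \<in> edges H. e \<subseteq> W})"

definition degree :: "'a hypergraph \<Rightarrow> 'a \<Rightarrow> nat" where
  "degree H x = card {e \<in> edges H. x \<in> e}"

text \<open>The condition \<open>y \<noteq> x\<close> is explicit because \<open>{x, x}\<close> is
  the singleton \<open>{x}\<close>, which may itself be an edge.\<close>

definition neighbours :: "'a hypergraph \<Rightarrow> 'a \<Rightarrow> 'a set" where
  "neighbours H x = {y \<in> verts H. y \<noteq> x \<and> {x, y} \<in> edges H}"

lemma verts_induced [simp]: "verts (induced H W) = W"
  and edges_induced [simp]: "edges (induced H W) = {e \<in> edges H. e \<subseteq> W}"
  by (simp_all add: induced_def)

lemma simplicial_complex_induced:
  "simplicial_complex H \<Longrightarrow> W \<subseteq> verts H \<Longrightarrow> simplicial_complex (induced H W)"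
  by (auto simp: simplicial_complex_def intro: finite_subset)

lemma simplicial_complex_finite_edges: "simplicial_complex H \<Longrightarrow> finite (edges H)"
  unfolding simplicial_complex_def by (meson finite_Pow_iff finite_subset)

lemma simplicial_complex_subset:
  "simplicial_complex H \<Longrightarrow> e \<in> edges H \<Longrightarrow> s \<subseteq> e \<Longrightarrow> s \<in> edges H"
  unfolding simplicial_complex_def by blast

lemma simplicial_complex_card_edges_le:
  assumes "simplicial_complex H"
  shows "card (edges H) \<le> 2 ^ card (verts H)"
  using assms unfolding simplicial_complex_def
  by (metis card_Pow card_mono finite_Pow_iff)

lemma finite_neighbours: "simplicial_complex H \<Longrightarrow> finite (neighbours H x)"
  by (auto simp: simplicial_complex_def neighbours_def)

lemma edge_minus_subset_neighbours:
  assumes "simplicial_complex H" "e \<in> edges H" "x \<in> e"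
  shows "e - {x} \<subseteq> neighbours H x"
  using assms simplicial_complex_subset[of H e "{x, _}"]
  by (auto simp: neighbours_def simplicial_complex_def)

text \<open>Deleting \<open>x\<close> maps the edges at \<open>x\<close> injectively to subsets of
  its neighbourhood. This crude bound serves the case \<open>card A = 1\<close>.\<close>

lemma degree_le_power:
  assumes "simplicial_complex H"
  shows "degree H x \<le> 2 ^ card (neighbours H x)"
proof -
  let ?D = "{e \<in> edges H. x \<in> e}"
  have "inj_on (\<lambda>e. e - {x}) ?D"
    by (auto simp: inj_on_def)
  moreover have "(\<lambda>e. e - {x}) ` ?D \<subseteq> Pow (neighbours H x)"
    using edge_minus_subset_neighbours[OF assms] by blast
  ultimately have "card ?D \<le> card (Pow (neighbours H x))"
    using finite_neighbours[OF assms] by (meson card_inj_on_le finite_Pow_iff)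
  then show ?thesis
    by (simp add: degree_def card_Pow finite_neighbours[OF assms])
qed

text \<open>Double counting: every edge at \<open>x\<close> other than \<open>{x}\<close> splits a
  unit weight equally among its remaining vertices, all of them neighbours of \<open>x\<close>. A
  neighbour \<open>y\<close> collects \<open>1 / i\<close> from each edge of size
  \<open>i + 1\<close> through \<open>x\<close> and \<open>y\<close>. Both \<open>n\<close> and
  \<open>D\<close> are mere upper bounds so that data of a whole complex can be used for an induced
  subcomplex.\<close>

lemma degree_le_neighbours:
  fixes D :: "nat \<Rightarrow> real"
  assumes H: "simplicial_complex H" and n: "card (verts H) \<le> n"
    and D: "\<And>i y. y \<in> verts H \<Longrightarrow> y \<noteq> x \<Longrightarrow> real (pair_degree H (i + 1) x y) \<le> D i"
  shows "real (degree H x) \<le> 1 + real (card (neighbours H x)) * (1 + (\<Sum>i=2..<n. D i / real i))"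
proof -
  let ?D = "{e \<in> edges H. x \<in> e \<and> e \<noteq> {x}}"
  let ?N = "neighbours H x"
  let ?w = "\<lambda>e. 1 / real (card e - 1)"
  have fE: "finite (edges H)" using H by (rule simplicial_complex_finite_edges)
  have fD: "finite ?D" using fE by simp
  have fN: "finite ?N" using H by (rule finite_neighbours)
  have fe: "finite e" "e \<subseteq> verts H" if "e \<in> edges H" for e
    using H that unfolding simplicial_complex_def by (auto intro: finite_subset)
  have "{e \<in> edges H. x \<in> e} \<subseteq> insert {x} ?D" by auto
  then have "degree H x \<le> card (insert {x} ?D)"
    unfolding degree_def by (rule card_mono[rotated]) (use fD in simp)
  also have "\<dots> = 1 + card ?D" using fD by simp
  finally have 1: "degree H x \<le> 1 + card ?D" .
  have weight: "(\<Sum>y | y \<in> ?N \<and> y \<in> e. ?w e) = 1" if e: "e \<in> ?D" for e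
  proof -
    have "{y. y \<in> ?N \<and> y \<in> e} = e - {x}"
      using edge_minus_subset_neighbours[OF H, of e x] e by (auto simp: neighbours_def)
    moreover have card: "card (e - {x}) = card e - 1" using e by simp
    moreover have "e - {x} \<noteq> {}" "finite (e - {x})" using e fe(1)[of e] by auto
    then have "card e - 1 \<noteq> 0" using card by (metis card_0_eq)
    ultimately show ?thesis by simp
  qed
  have pair: "(\<Sum>e | e \<in> ?D \<and> y \<in> e. ?w e) \<le> 1 + (\<Sum>i=2..<n. D i / real i)" if y: "y \<in> ?N" for y
  proof -
    let ?S = "{e \<in> edges H. x \<in> e \<and> y \<in> e}"
    have yx: "y \<noteq> x" "y \<in> verts H" "{x,y} \<in> edges H" using y by (auto simp: neighbours_def)
    have S: "{e. e \<in> ?D \<and> y \<in> e} = ?S" using yx by auto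
    have fS: "finite ?S" using fE by simp
    have ge2: "2 \<le> card e" if "e \<in> ?S" for e
    proof -
      have "card {x,y} \<le> card e" using that fe by (intro card_mono) auto
      then show ?thesis using yx by simp
    qed
    have len: "card e \<le> n" if "e \<in> ?S" for e
      using that fe n H unfolding simplicial_complex_def
      by (metis (no_types, lifting) card_mono le_trans mem_Collect_eq)
    have n2: "2 \<le> n" using ge2[of "{x,y}"] len[of "{x,y}"] yx by simp
    \<comment> \<open>The index \<open>i\<close> is the edge size minus one; \<open>i = 1\<close>
      occurs only for \<open>{x, y}\<close> and produces the leading \<open>1\<close>.\<close>
    have "(\<Sum>e\<in>?S. ?w e) = (\<Sum>i\<in>{1..<n}. \<Sum>e | e \<in> ?S \<and> card e - 1 = i. ?w e)"
      using ge2 len by (intro sum.group[symmetric] fS) force+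
    also have "\<dots> = (\<Sum>i\<in>{1..<n}. real (pair_degree H (i + 1) x y) / real i)"
    proof (rule sum.cong[OF refl])
      fix i assume i: "i \<in> {1..<n}"
      have "{e. e \<in> ?S \<and> card e - 1 = i} = {e \<in> edges H. card e = i + 1 \<and> x \<in> e \<and> y \<in> e}"
        using i by auto
      moreover have "(\<Sum>e | e \<in> ?S \<and> card e - 1 = i. ?w e) = (\<Sum>e | e \<in> ?S \<and> card e - 1 = i. 1 / real i)"
        by (rule sum.cong) auto
      ultimately show "(\<Sum>e | e \<in> ?S \<and> card e - 1 = i. ?w e) = real (pair_degree H (i + 1) x y) / real i"
        by (simp add: pair_degree_def)
    qed
    also have "\<dots> = real (pair_degree H 2 x y) + (\<Sum>i\<in>{2..<n}. real (pair_degree H (i + 1) x y) / real i)"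
      using n2 by (simp add: sum.atLeast_Suc_lessThan numeral_2_eq_2)
    also have "pair_degree H 2 x y = 1"
    proof -
      have "{e \<in> edges H. card e = 2 \<and> x \<in> e \<and> y \<in> e} = {{x,y}}"
        using yx by (auto simp: card_2_iff)
      then show ?thesis by (simp add: pair_degree_def)
    qed
    finally have "(\<Sum>e\<in>?S. ?w e) = 1 + (\<Sum>i\<in>{2..<n}. real (pair_degree H (i + 1) x y) / real i)"
      by simp
    also have "\<dots> \<le> 1 + (\<Sum>i=2..<n. D i / real i)"
      by (intro add_left_mono sum_mono divide_right_mono D) (use yx in auto)
    finally show ?thesis unfolding S .
  qed
  have "real (card ?D) = (\<Sum>e\<in>?D. \<Sum>y | y \<in> ?N \<and> y \<in> e. ?w e)"
    using sum.cong[OF refl weight, of ?D] by simp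
  also have "\<dots> = (\<Sum>y\<in>?N. \<Sum>e | e \<in> ?D \<and> y \<in> e. ?w e)"
    by (rule sum.swap_restrict[OF fD fN])
  also have "\<dots> \<le> (\<Sum>y\<in>?N. 1 + (\<Sum>i=2..<n. D i / real i))"
    by (rule sum_mono) (rule pair)
  finally show ?thesis using 1 by simp
qed

section \<open>Pair degrees of subcomplexes and the deletion of vertices of low degree\<close>

lemma pair_degree_induced_le:
  assumes "simplicial_complex H"
  shows "pair_degree (induced H W) i x y \<le> pair_degree H i x y"
  unfolding pair_degree_def
  by (rule card_mono) (use simplicial_complex_finite_edges[OF assms] in auto)

lemma pair_degree_le_max:
  assumes "simplicial_complex H" "x \<in> verts H" "y \<in> verts H" "x \<noteq> y"
  shows "pair_degree H i x y \<le> max_pair_degree H i"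
proof -
  have "{pair_degree H i x y | x y. x \<in> verts H \<and> y \<in> verts H \<and> x \<noteq> y}
      \<subseteq> (\<lambda>(x, y). pair_degree H i x y) ` (verts H \<times> verts H)" by auto
  then have "finite {pair_degree H i x y | x y. x \<in> verts H \<and> y \<in> verts H \<and> x \<noteq> y}"
    using assms(1) unfolding simplicial_complex_def by (meson finite_SigmaI finite_imageI finite_subset)
  then show ?thesis
    unfolding max_pair_degree_def using assms by (intro Max_ge) auto
qed

text \<open>A maximizer of the edge count minus the accumulated thresholds plays the role of the end
  state of greedily deleting vertices of low degree.\<close>

lemma exists_induced_min_degree:
  fixes t :: "nat \<Rightarrow> real"
  assumes H: "simplicial_complex H"
  obtains W where "W \<subseteq> verts H"
    and "\<And>x. x \<in> W \<Longrightarrow> t (card W) \<le> real (degree (induced H W) x)"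
    and "real (card (edges H)) - (\<Sum>j\<in>{card W<..card (verts H)}. t j)
           \<le> real (card (edges (induced H W)))"
proof -
  define P where "P W = real (card (edges (induced H W))) - (\<Sum>j\<in>{0<..card W}. t j)" for W
  have fV: "finite (verts H)" using H by (simp add: simplicial_complex_def)
  have fE: "finite (edges H)" using H by (rule simplicial_complex_finite_edges)
  obtain W where W: "W \<subseteq> verts H" "\<And>W'. W' \<subseteq> verts H \<Longrightarrow> P W' \<le> P W"
  proof -
    have "finite (P ` Pow (verts H))" using fV by simp
    then have "Max (P ` Pow (verts H)) \<in> P ` Pow (verts H)"
      by (intro Max_in) auto
    then obtain W where "W \<subseteq> verts H" "P W = Max (P ` Pow (verts H))" by auto
    then show ?thesis using that[of W] fV by simp
  qed
  have fW: "finite W" using W(1) fV by (rule finite_subset)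
  show ?thesis
  proof (rule that[of W])
    show "W \<subseteq> verts H" by fact
    fix x assume x: "x \<in> W"
    have c: "card W = Suc (card (W - {x}))" using fW x by (metis card.remove card_Diff_singleton)
    let ?D = "{e \<in> edges (induced H W). x \<in> e}"
    have "{e \<in> edges H. e \<subseteq> W} = {e \<in> edges H. e \<subseteq> W - {x}} \<union> ?D"
      by auto
    moreover have "card ({e \<in> edges H. e \<subseteq> W - {x}} \<union> ?D) = card {e \<in> edges H. e \<subseteq> W - {x}} + card ?D"
      by (rule card_Un_disjoint) (use fE in auto)
    ultimately have "card {e \<in> edges H. e \<subseteq> W} = card {e \<in> edges H. e \<subseteq> W - {x}} + degree (induced H W) x"
      by (simp only: degree_def)
    moreover have "{0<..card W} = insert (card W) {0<..card (W - {x})}" using c by auto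
    then have "(\<Sum>j\<in>{0<..card W}. t j) = t (card W) + (\<Sum>j\<in>{0<..card (W - {x})}. t j)"
      using c by simp
    \<comment> \<open>Maximality against \<open>W - {x}\<close> gives the degree bound; comparison
      with all of \<open>verts H\<close> below gives the edge bound.\<close>
    moreover have "P (W - {x}) \<le> P W" using W by blast
    ultimately show "t (card W) \<le> real (degree (induced H W) x)" by (simp add: P_def)
  next
    have "{e \<in> edges H. e \<subseteq> verts H} = edges H" using H by (auto simp: simplicial_complex_def)
    then have "P (verts H) = real (card (edges H)) - (\<Sum>j\<in>{0<..card (verts H)}. t j)"
      by (simp add: P_def)
    moreover have "card W \<le> card (verts H)" using W(1) fV by (rule card_mono[rotated])
    then have "{0<..card (verts H)} = {0<..card W} \<union> {card W<..card (verts H)}" by auto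
    then have "(\<Sum>j\<in>{0<..card (verts H)}. t j)
        = (\<Sum>j\<in>{0<..card W}. t j) + (\<Sum>j\<in>{card W<..card (verts H)}. t j)"
      by (simp add: sum.union_disjoint)
    ultimately show "real (card (edges H)) - (\<Sum>j\<in>{card W<..card (verts H)}. t j)
        \<le> real (card (edges (induced H W)))"
      using W(2)[of "verts H"] by (simp add: P_def)
  qed
qed

section \<open>Finding copies of \<open>F\<close> and of its extension\<close>

text \<open>Since \<open>ex3\<close> ranges only over hypergraphs on \<open>{..<n}\<close>,
  \<open>G\<close> is relabelled along a bijection; a copy of \<open>F\<close> in the relabelled
  hypergraph pulls back to \<open>G\<close>.\<close>

lemma card_edges_le_ex3:
  assumes G: "three_graph G" and free: "\<not> contains_copy G F"
  shows "card (edges G) \<le> ex3 (card (verts G)) F"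
proof -
  let ?n = "card (verts G)"
  let ?X = "{card (edges G) | G :: nat hypergraph.
     three_graph G \<and> verts G = {..<?n} \<and> \<not> contains_copy G F}"
  have "finite (verts G)" using G by (simp add: three_graph_def)
  then obtain f where f: "bij_betw f (verts G) {..<?n}"
    using ex_bij_betw_finite_nat[of "verts G"] by (auto simp: atLeast0LessThan)
  then have inj: "inj_on f (verts G)" and im: "f ` verts G = {..<?n}" by (auto simp: bij_betw_def)
  have sub: "e \<subseteq> verts G" "card e = 3" if "e \<in> edges G" for e using G that by (auto simp: three_graph_def)
  define G' where "G' = ({..<?n}, image f ` edges G)"
  have tg: "three_graph G'"
    unfolding three_graph_def
  proof (intro conjI ballI)
    show "finite (verts G')" by (simp add: G'_def)
  next
    fix e assume "e \<in> edges G'"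
    then obtain e' where e': "e' \<in> edges G" "e = f ` e'" by (auto simp: G'_def)
    show "e \<subseteq> verts G'" using sub(1)[OF e'(1)] im e'(2) by (auto simp: G'_def)
    show "card e = 3" using e' sub card_image[OF inj_on_subset[OF inj sub(1)[OF e'(1)]]] by simp
  qed
  have "\<not> contains_copy G' F"
  proof
    assume "contains_copy G' F"
    then obtain \<phi> where \<phi>: "inj_on \<phi> (verts F)" "\<phi> ` verts F \<subseteq> {..<?n}" "\<forall>e\<in>edges F. \<phi> ` e \<in> image f ` edges G"
      by (auto simp: contains_copy_def G'_def)
    let ?g = "inv_into (verts G) f"
    have "inj_on (?g \<circ> \<phi>) (verts F)"
      using \<phi>(1,2) im by (metis comp_inj_on inj_on_inv_into)
    moreover have "(?g \<circ> \<phi>) ` verts F \<subseteq> verts G"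
      using \<phi>(2) im by (auto simp: inv_into_into subset_iff)
    moreover have "(?g \<circ> \<phi>) ` e \<in> edges G" if e: "e \<in> edges F" for e
    proof -
      obtain e' where e': "e' \<in> edges G" "\<phi> ` e = f ` e'" using bspec[OF \<phi>(3) e] by (rule imageE)
      have "?g ` f ` e' = e'" using inj sub(1)[OF e'(1)] by (rule inv_into_image_cancel)
      moreover have "(?g \<circ> \<phi>) ` e = ?g ` f ` e'" using e'(2) by (metis image_comp)
      ultimately show ?thesis using e'(1) by simp
    qed
    ultimately show False using free unfolding contains_copy_def by blast
  qed
  moreover have "card (edges G') = card (edges G)"
    unfolding G'_def using sub
    by (simp, intro card_image inj_on_subset[OF inj_on_image_Pow[OF inj]]) auto
  ultimately have "card (edges G) \<in> ?X" using tg by (force simp: G'_def)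
  \<comment> \<open>On naturals, \<open>Sup\<close> is known to dominate the elements of a set only
    if the set is bounded.\<close>
  moreover have "bdd_above ?X"
  proof (rule bdd_aboveI)
    fix k assume "k \<in> ?X"
    then obtain G\<^sub>0 :: "nat hypergraph" where "k = card (edges G\<^sub>0)" "three_graph G\<^sub>0" "verts G\<^sub>0 = {..<?n}"
      by blast
    moreover from this have "edges G\<^sub>0 \<subseteq> Pow {..<?n}" by (auto simp: three_graph_def)
    ultimately show "k \<le> card (Pow {..<?n})" by (metis card_mono finite_Pow_iff finite_lessThan)
  qed
  ultimately show ?thesis unfolding ex3_def by (rule cSup_upper)
qed

text \<open>Without 4-edges, downward closure leaves only edges of size at most 3. Those of size at
  most 2 number at most \<open>1 + n + (n choose 2)\<close>, where
  \<open>n = card (verts H)\<close>, so the 3-edges exceed \<open>ex3\<close>. Otherwise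
  \<open>four\<close> places \<open>F\<close> inside any 4-edge.\<close>

lemma contains_copy_of_many_edges:
  assumes H: "simplicial_complex H"
    and many: "card (edges H) > ex3 (card (verts H)) F + (card (verts H) choose 2) + card (verts H) + 1"
    and four: "(\<forall>e\<in>edges H. card e \<noteq> 4) \<or> contains_copy (complete_three_graph 4) F"
  shows "contains_copy H F"
proof (cases "\<forall>e\<in>edges H. card e \<noteq> 4")
  case True
  let ?V = "verts H"
  let ?T = "{e \<in> edges H. card e = 3}"
  have fV: "finite ?V" and sub: "edges H \<subseteq> Pow ?V" using H by (auto simp: simplicial_complex_def)
  have le3: "card e \<le> 3" if e: "e \<in> edges H" for e
  proof (rule ccontr)
    assume "\<not> card e \<le> 3"
    then obtain s where "s \<subseteq> e" "card s = 4"
      using obtain_subset_with_card_n[of 4 e] by auto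
    then show False using True simplicial_complex_subset[OF H e] by blast
  qed
  have "edges H \<subseteq> {s. s \<subseteq> ?V \<and> card s = 0} \<union> {s. s \<subseteq> ?V \<and> card s = 1} \<union> {s. s \<subseteq> ?V \<and> card s = 2} \<union> ?T"
    using le3 sub by (fastforce simp: le_Suc_eq numeral_3_eq_3 numeral_2_eq_2)
  then have "card (edges H) \<le> card ({s. s \<subseteq> ?V \<and> card s = 0} \<union> {s. s \<subseteq> ?V \<and> card s = 1} \<union> {s. s \<subseteq> ?V \<and> card s = 2} \<union> ?T)"
    by (rule card_mono[rotated]) (use fV simplicial_complex_finite_edges[OF H] in auto)
  also have "\<dots> \<le> card {s. s \<subseteq> ?V \<and> card s = 0} + card {s. s \<subseteq> ?V \<and> card s = 1} + card {s. s \<subseteq> ?V \<and> card s = 2} + card ?T"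
    by (meson add_le_mono card_Un_le le_refl le_trans)
  also have "\<dots> = 1 + card ?V + (card ?V choose 2) + card ?T"
    by (simp only: n_subsets[OF fV] binomial_n_0 choose_one)
  finally have "card ?T > ex3 (card ?V) F" using many by linarith
  moreover have "three_graph (?V, ?T)" using fV sub by (auto simp: three_graph_def)
  ultimately have "contains_copy (?V, ?T) F"
    using card_edges_le_ex3[of "(?V, ?T)" F] by (metis fst_conv linorder_not_less snd_conv)
  then show ?thesis unfolding contains_copy_def by auto
next
  case False
  then obtain q where q: "q \<in> edges H" "card q = 4" by blast
  then have fq: "finite q" by (metis card.infinite zero_neq_numeral)
  obtain g where g: "bij_betw g {..<4::nat} q"
    using ex_bij_betw_nat_finite[OF fq] q(2) by (auto simp: atLeast0LessThan)
  \<comment> \<open>Of the images of edges only their containment in \<open>{..<4}\<close> is kept,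
    as every subset of the 4-edge \<open>q\<close> is an edge of \<open>H\<close>.\<close>
  obtain \<phi> where \<phi>: "inj_on \<phi> (verts F)" "\<phi> ` verts F \<subseteq> {..<4::nat}" "\<forall>e\<in>edges F. \<phi> ` e \<subseteq> {..<4}"
    using four False unfolding contains_copy_def complete_three_graph_def by auto
  have g': "inj_on g {..<4}" "g ` {..<4} = q" using g by (auto simp: bij_betw_def)
  have "inj_on (g \<circ> \<phi>) (verts F)" using \<phi>(1,2) g'(1) by (meson comp_inj_on inj_on_subset)
  moreover have "(g \<circ> \<phi>) ` e \<subseteq> q" if "\<phi> ` e \<subseteq> {..<4}" for e
    using that g'(2) by (metis image_comp image_mono)
  moreover have "q \<subseteq> verts H" using H q(1) by (auto simp: simplicial_complex_def)
  ultimately show ?thesis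
    unfolding contains_copy_def using \<phi>(2,3) simplicial_complex_subset[OF H q(1)]
    by (meson order_trans)
qed

text \<open>\<open>None\<close> is sent to a common neighbour of the image of \<open>A\<close>,
  chosen outside the copy to keep the map injective. As the copy is not known in advance,
  \<open>common\<close> speaks of all \<open>U\<close> and \<open>B\<close> of the right
  sizes.\<close>

lemma contains_plus_complex:
  assumes H: "simplicial_complex H" and A: "A \<subseteq> verts F"
    and copy: "contains_copy H F"
    and common: "\<And>U B. B \<subseteq> U \<Longrightarrow> U \<subseteq> verts H \<Longrightarrow> card U = card (verts F) \<Longrightarrow> card B = card A
      \<Longrightarrow> \<exists>y \<in> verts H - U. \<forall>b\<in>B. y \<in> neighbours H b"
  shows "contains_copy H (plus_complex F A)"
proof -
  obtain \<phi> where \<phi>: "inj_on \<phi> (verts F)" "\<phi> ` verts F \<subseteq> verts H" "\<forall>e\<in>edges F. \<phi> ` e \<in> edges H"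
    using copy by (auto simp: contains_copy_def)
  have "card (\<phi> ` verts F) = card (verts F)" "card (\<phi> ` A) = card A"
    using \<phi>(1) A by (auto intro: card_image inj_on_subset)
  then obtain y where y: "y \<in> verts H" "y \<notin> \<phi> ` verts F" "\<forall>b\<in>\<phi> ` A. y \<in> neighbours H b"
    using common[of "\<phi> ` A" "\<phi> ` verts F"] \<phi>(2) A by blast
  define \<psi> where "\<psi> = case_option y \<phi>"
  have [simp]: "\<psi> None = y" "\<psi> (Some x) = \<phi> x" for x by (simp_all add: \<psi>_def)
  have "inj_on \<psi> (insert None (Some ` verts F))"
    using \<phi>(1) y(2) by (auto simp: inj_on_def)
  moreover have "\<psi> ` insert None (Some ` verts F) \<subseteq> verts H" using y \<phi>(2) by auto
  moreover have "\<psi> ` s \<in> edges H" if s: "s \<in> edges (plus_complex F A)" for s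
  proof -
    obtain e where e: "s \<subseteq> e" "e \<in> (\<lambda>e. Some ` e) ` edges F \<union> {{None, Some x} | x. x \<in> A}"
      using s unfolding plus_complex_def down_closure_def by auto
    \<comment> \<open>Checking the generating sets suffices, since \<open>H\<close> is closed under
      subsets.\<close>
    have "\<psi> ` e \<in> edges H"
      using e(2) \<phi>(3) y(3) by (auto simp: image_image neighbours_def insert_commute)
    then show ?thesis using e(1) simplicial_complex_subset[OF H] by (meson image_mono)
  qed
  ultimately show ?thesis
    unfolding contains_copy_def by (intro exI[of _ \<psi>]) (simp add: plus_complex_def)
qed

text \<open>If no such \<open>y\<close> exists, the non-neighbourhoods of the vertices in
  \<open>B\<close> cover everything outside \<open>U - B\<close>. The bound in \<open>deg\<close> is
  exactly what makes their total size too small for that.\<close>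

lemma exists_common_neighbour:
  assumes H: "simplicial_complex H" and U: "B \<subseteq> U" "U \<subseteq> verts H" and B: "B \<noteq> {}"
    and deg: "\<And>x. x \<in> verts H \<Longrightarrow> real (card (neighbours H x))
      > (real (card B) - 1) / real (card B) * real (card (verts H))
        + (real (card U) - real (card B)) / real (card B)"
  shows "\<exists>y \<in> verts H - U. \<forall>b\<in>B. y \<in> neighbours H b"
proof (rule ccontr)
  assume no: "\<not> ?thesis"
  let ?V = "verts H" and ?N = "neighbours H"
  let ?a = "real (card B)" and ?m = "real (card (verts H))"
  let ?d = "(?a - 1) / ?a * ?m + (real (card U) - ?a) / ?a"
  have fV: "finite ?V" using H by (simp add: simplicial_complex_def)
  have fU: "finite U" using U(2) fV by (rule finite_subset)
  have fB: "finite B" using U(1) fU by (rule finite_subset)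
  have a: "?a > 0" using B fB by (simp add: card_gt_0_iff)
  \<comment> \<open>Vertices of \<open>B\<close> are covered too, since no vertex is its own
    neighbour; hence only \<open>U - B\<close> is removed.\<close>
  have "?V - (U - B) \<subseteq> (\<Union>b\<in>B. ?V - ?N b)"
    using no U by (auto simp: neighbours_def)
  then have "card (?V - (U - B)) \<le> card (\<Union>b\<in>B. ?V - ?N b)"
    by (rule card_mono[rotated]) (use fV fB in auto)
  also have "\<dots> \<le> (\<Sum>b\<in>B. card (?V - ?N b))" using fB by (rule card_UN_le)
  finally have le: "real (card (?V - (U - B))) \<le> (\<Sum>b\<in>B. real (card (?V - ?N b)))"
    by (metis of_nat_le_iff of_nat_sum)
  have "card (?V - (U - B)) = card ?V - card (U - B)"
    using U(2) fU by (intro card_Diff_subset) auto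
  moreover have "card (U - B) = card U - card B" using U(1) fB by (intro card_Diff_subset) auto
  ultimately have l: "real (card (?V - (U - B))) = ?m - (real (card U) - ?a)"
    using card_mono[OF fV U(2)] card_mono[OF fU U(1)] by simp
  have "(\<Sum>b\<in>B. real (card (?V - ?N b))) < (\<Sum>b\<in>B. ?m - ?d)"
  proof (rule sum_strict_mono[OF fB B])
    fix b assume b: "b \<in> B"
    have s: "?N b \<subseteq> ?V" by (auto simp: neighbours_def)
    have "real (card (?V - ?N b)) = ?m - real (card (?N b))"
      using s fV by (simp add: card_Diff_subset finite_subset card_mono of_nat_diff)
    then show "real (card (?V - ?N b)) < ?m - ?d" using deg[of b] b U by auto
  qed
  also have "\<dots> = ?m - (real (card U) - ?a)" using a by (simp add: field_simps)
  finally show False using le l by linarith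
qed

section \<open>Transfer from induced subcomplexes, and the growth of \<open>ex3\<close> under
  properness\<close>

lemma contains_copy_induced:
  "contains_copy (induced H W) F \<Longrightarrow> W \<subseteq> verts H \<Longrightarrow> contains_copy H F"
  unfolding contains_copy_def by fastforce

text \<open>Properness with parameter \<open>\<delta>\<close> makes \<open>ex3 n F\<close> grow at least like \<open>n powr (1 / (1 + \<delta>))\<close>.\<close>

lemma turan_proper_ratio:
  assumes proper: "turan_proper F" and \<eta>: "\<eta> > 0"
  obtains N where "\<And>m n. N \<le> m \<Longrightarrow> m \<le> n \<Longrightarrow> real (ex3 m F) \<le> (real m / real n + \<eta>) * real (ex3 n F)"
proof -
  define \<delta> where "\<delta> = \<eta> / 2"
  define \<beta> where "\<beta> = 1 / (1 + \<delta>)"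
  have \<delta>: "\<delta> > 0" using \<eta> by (simp add: \<delta>_def)
  have \<beta>: "0 < \<beta>" "\<beta> < 1" "1 - \<beta> \<le> \<delta>" using \<delta> by (auto simp: \<beta>_def field_simps)
  obtain N0 where N0: "\<And>n. n \<ge> N0 \<Longrightarrow>
      (1 + \<delta>) * (real (ex3 n F) - real (ex3 (n - 1) F)) \<ge> real (ex3 n F) / real n"
    using proper \<delta> unfolding turan_proper_def by blast
  \<comment> \<open>Properness becomes a telescoping factor. The shift by one matters: it lets
    \<open>ln (1 + 1 / (j + 1)) \<le> 1 / (j + 1)\<close> be used, whereas
    \<open>(j / (j + 1)) powr \<beta>\<close> is at most \<open>1 - \<beta> / (j + 1)\<close> by
    Bernoulli, the wrong direction.\<close>
  have growth: "real (ex3 j F) \<le> ((real j + 1) / (real j + 2)) powr \<beta> * real (ex3 (Suc j) F)" if "j \<ge> N0" for j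
  proof -
    let ?E = "real (ex3 (Suc j) F)"
    have "real (ex3 j F) \<le> (1 - \<beta> / (real j + 1)) * ?E"
    proof -
      have "?E / (real j + 1) \<le> (1 + \<delta>) * (?E - real (ex3 j F))"
        using N0[of "Suc j"] that by (simp add: add.commute)
      then have "\<beta> * (?E / (real j + 1)) \<le> \<beta> * ((1 + \<delta>) * (?E - real (ex3 j F)))"
        using \<beta>(1) by (intro mult_left_mono) auto
      also have "\<dots> = ?E - real (ex3 j F)" using \<delta> by (simp add: \<beta>_def)
      finally show ?thesis by (simp add: algebra_simps)
    qed
    also have "\<dots> \<le> ((real j + 1) / (real j + 2)) powr \<beta> * ?E"
    proof (rule mult_right_mono)
      have "ln (1 + 1 / (real j + 1)) \<le> 1 / (real j + 1)"
        by (rule ln_add_one_self_le_self) simp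
      moreover have "1 + 1 / (real j + 1) = (real j + 2) / (real j + 1)" by (simp add: field_simps)
      ultimately have "- (1 / (real j + 1)) \<le> ln ((real j + 1) / (real j + 2))"
        by (simp add: ln_div)
      then have "- (\<beta> / (real j + 1)) \<le> \<beta> * ln ((real j + 1) / (real j + 2))"
        using mult_left_mono[OF _ less_imp_le[OF \<beta>(1)]] by fastforce
      then have "exp (- (\<beta> / (real j + 1))) \<le> ((real j + 1) / (real j + 2)) powr \<beta>"
        by (simp add: powr_def)
      then show "1 - \<beta> / (real j + 1) \<le> ((real j + 1) / (real j + 2)) powr \<beta>"
        using exp_ge_add_one_self[of "- (\<beta> / (real j + 1))"] by linarith
    qed simp
    finally show ?thesis .
  qed
  have power: "real (ex3 m F) \<le> ((real m + 1) / (real n + 1)) powr \<beta> * real (ex3 n F)"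
    if "N0 \<le> m" "m \<le> n" for m n
    using that(2)
  proof (induction n rule: dec_induct)
    case base
    then show ?case by simp
  next
    case (step j)
    have "real (ex3 m F) \<le> ((real m + 1) / (real j + 1)) powr \<beta> * real (ex3 j F)" by (rule step.IH)
    also have "\<dots> \<le> ((real m + 1) / (real j + 1)) powr \<beta> *
        (((real j + 1) / (real j + 2)) powr \<beta> * real (ex3 (Suc j) F))"
      by (rule mult_left_mono) (use growth that(1) step.hyps in auto)
    also have "\<dots> = ((real m + 1) / (real j + 1) * ((real j + 1) / (real j + 2))) powr \<beta> * real (ex3 (Suc j) F)"
      by (simp only: powr_mult mult.assoc)
    also have "(real m + 1) / (real j + 1) * ((real j + 1) / (real j + 2)) = (real m + 1) / (real (Suc j) + 1)"
      using times_divide_times_eq[of "real m + 1" "real j + 1"] by (simp add: add.commute)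
    finally show ?case .
  qed
  obtain N1 :: nat where N1: "real N1 \<ge> 1 / \<delta>" using real_arch_simple by blast
  show ?thesis
  proof (rule that[of "max N0 (Suc N1)"])
    fix m n :: nat assume m: "max N0 (Suc N1) \<le> m" and mn: "m \<le> n"
    let ?y = "(real m + 1) / (real n + 1)"
    have n: "real n > 0" "1 / \<delta> \<le> real n" using m mn N1 by auto
    have "1 / real n \<le> \<delta>" using n \<delta> by (simp add: field_simps)
    moreover have "?y \<le> real m / real n + 1 / real n" using n mn by (simp add: field_simps)
    \<comment> \<open>Weighted AM-GM with second factor \<open>1\<close> leads to
      \<open>?y powr \<beta> \<le> ?y + \<delta>\<close>. The shift inside \<open>?y\<close> costs
      another \<open>1 / n \<le> \<delta>\<close>, and
      \<open>\<delta> + \<delta> = \<eta>\<close>.\<close>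
    moreover have "?y powr \<beta> * 1 powr (1 - \<beta>) \<le> \<beta> * ?y + (1 - \<beta>) * 1"
      by (rule Youngs_inequality_0) (use \<beta> in auto)
    moreover have "\<beta> * ?y \<le> 1 * ?y" using \<beta> by (intro mult_right_mono) auto
    ultimately have "?y powr \<beta> \<le> real m / real n + \<eta>"
      using \<beta>(3) \<delta>_def by simp
    then have "?y powr \<beta> * real (ex3 n F) \<le> (real m / real n + \<eta>) * real (ex3 n F)"
      by (rule mult_right_mono) simp
    then show "real (ex3 m F) \<le> (real m / real n + \<eta>) * real (ex3 n F)"
      using power[of m n] m mn by linarith
  qed
qed

section \<open>Estimates for the deletion cost and the surviving edges\<close>

lemma sum_greaterThanAtMost_real:
  assumes "m \<le> n"
  shows "(\<Sum>j\<in>{m<..n}. real j) = (real n * (real n + 1) - real m * (real m + 1)) / 2"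
  using assms
proof (induction n rule: dec_induct)
  case (step n)
  have "{m<..Suc n} = insert (Suc n) {m<..n}" using step.hyps by auto
  then show ?case using step.IH by (simp add: field_simps)
qed simp

text \<open>\<open>M\<close> stands for the larger side of the numerical hypothesis on
  \<open>H\<close>, \<open>Q\<close> for \<open>ex3 n F + n\<^sup>2\<close>. Since
  \<open>p * K\<close> is at most about \<open>Q / n\<^sup>2\<close>, summing
  \<open>p * K * j\<close> over \<open>m < j \<le> n\<close> gives the main term
  \<open>Q * (1 - (m / n)\<^sup>2) / 2\<close>; lower-order terms are absorbed by
  \<open>2 * \<eta> * Q\<close>.\<close>

lemma threshold_sum_le:
  fixes p q K M Q \<eta> :: real and m n :: nat
  assumes p: "1 / 2 \<le> p" and q: "0 \<le> q" and K: "0 \<le> K" and pqK: "(p + q / real n) * K \<le> M"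
    and M: "M \<le> (1 + \<eta>) * Q / (real n)\<^sup>2" and Q: "(real n)\<^sup>2 \<le> Q" and \<eta>: "0 < \<eta>" "\<eta> \<le> 1"
    and n: "4 * (2 * q + 1) \<le> \<eta> * real n" and mn: "m \<le> n"
  shows "(\<Sum>j\<in>{m<..n}. 2 + (p * real j + q) * K) \<le> Q * ((1 - (real m / real n)\<^sup>2) / 2 + 2 * \<eta>)"
proof -
  define N where "N = real n"
  define x where "x = real m"
  define R where "R = Q / N\<^sup>2"
  have N: "0 < N"
  proof -
    have "0 < \<eta> * N" using n q by (simp add: N_def)
    then show ?thesis using \<eta> by (simp add: zero_less_mult_iff)
  qed
  have x: "0 \<le> x" "x \<le> N" using mn by (auto simp: x_def N_def)
  have R: "R * N\<^sup>2 = Q" "1 \<le> R" using N Q by (auto simp: R_def N_def field_simps)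
  have M': "M \<le> (1 + \<eta>) * R" using M by (simp add: R_def N_def)
  have qKn: "0 \<le> q / N * K" using q K N by simp
  then have pK: "p * K \<le> M" using pqK by (simp add: N_def algebra_simps)
  have M0: "0 \<le> M" using pK p K by (meson order_trans mult_nonneg_nonneg zero_le_divide_1_iff zero_le_numeral)
  \<comment> \<open>As \<open>p\<close> is at least one half, \<open>M\<close> also controls
    \<open>K\<close> alone, hence the terms with \<open>q\<close>.\<close>
  have "1 / 2 * K \<le> p * K" using p K by (rule mult_right_mono)
  then have "K \<le> 2 * M" using pK by simp
  then have qK: "q * K \<le> q * (2 * M)" using q by (rule mult_left_mono)
  have "(\<Sum>j\<in>{m<..n}. 2 + (p * real j + q) * K) = (\<Sum>j\<in>{m<..n}. (2 + q * K) + p * K * real j)"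
    by (rule sum.cong) (simp_all add: algebra_simps)
  also have "\<dots> = (N - x) * (2 + q * K) + p * K * ((N * (N + 1) - x * (x + 1)) / 2)"
    using mn by (simp add: sum.distrib sum_distrib_left[symmetric] sum_greaterThanAtMost_real N_def x_def of_nat_diff)
  also have "\<dots> \<le> N * (2 + q * (2 * M)) + M * ((N\<^sup>2 - x\<^sup>2 + N) / 2)"
  proof (rule add_mono)
    show "(N - x) * (2 + q * K) \<le> N * (2 + q * (2 * M))"
      by (rule mult_mono) (use x qK q K N in auto)
    have "x * (x + 1) \<le> N * (N + 1)" using x by (intro mult_mono) auto
    moreover have "N * (N + 1) - x * (x + 1) \<le> N\<^sup>2 - x\<^sup>2 + N"
      using x by (simp add: power2_eq_square algebra_simps)
    ultimately show "p * K * ((N * (N + 1) - x * (x + 1)) / 2) \<le> M * ((N\<^sup>2 - x\<^sup>2 + N) / 2)"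
      by (intro mult_mono pK divide_right_mono) (use M0 in auto)
  qed
  also have "\<dots> = 2 * N + M * (2 * q * N + N / 2 + (N\<^sup>2 - x\<^sup>2) / 2)" by (simp add: field_simps)
  also have "\<dots> \<le> 2 * N + (1 + \<eta>) * R * (2 * q * N + N / 2 + (N\<^sup>2 - x\<^sup>2) / 2)"
    using x N q by (intro add_left_mono mult_right_mono M') (simp add: power_mono)
  also have "\<dots> = 2 * N + R * ((1 + \<eta>) * (2 * q * N + N / 2) + (1 + \<eta>) * ((N\<^sup>2 - x\<^sup>2) / 2))"
    by (simp add: algebra_simps)
  \<comment> \<open>The error is \<open>\<eta> * Q\<close> for \<open>2 * N\<close>, plus
    \<open>R\<close> times half of \<open>\<eta> * N\<^sup>2\<close> for the linear terms and the
    same for the factor \<open>1 + \<eta>\<close> of the quadratic one; as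
    \<open>R * N\<^sup>2 = Q\<close>, the total is \<open>2 * \<eta> * Q\<close>.\<close>
  also have "\<dots> \<le> \<eta> * Q + R * (\<eta> * N\<^sup>2 / 2 + ((N\<^sup>2 - x\<^sup>2) / 2 + \<eta> * N\<^sup>2 / 2))"
  proof (intro add_mono mult_left_mono)
    have *: "4 * (2 * q + 1) * N \<le> \<eta> * N * N" using n N by (intro mult_right_mono) (auto simp: N_def)
    have qN: "0 \<le> q * N" using q N by simp
    have **: "8 * (q * N) + 4 * N \<le> \<eta> * N\<^sup>2" using * by (simp add: algebra_simps power2_eq_square)
    then have "2 * N \<le> \<eta> * N\<^sup>2" using qN N by linarith
    also have "\<dots> \<le> \<eta> * Q" using Q \<eta> by (simp add: N_def)
    finally show "2 * N \<le> \<eta> * Q" .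
    have "(1 + \<eta>) * (2 * q * N + N / 2) \<le> 2 * (2 * q * N + N / 2)"
      using \<eta> qN N by (intro mult_right_mono) auto
    also have "\<dots> = 4 * (q * N) + N" by simp
    also have "\<dots> \<le> \<eta> * N\<^sup>2 / 2" using ** N qN by linarith
    finally show "(1 + \<eta>) * (2 * q * N + N / 2) \<le> \<eta> * N\<^sup>2 / 2" .
    have "0 \<le> \<eta> * x\<^sup>2" using \<eta> by simp
    then show "(1 + \<eta>) * ((N\<^sup>2 - x\<^sup>2) / 2) \<le> (N\<^sup>2 - x\<^sup>2) / 2 + \<eta> * N\<^sup>2 / 2"
      by (simp add: field_simps)
    show "0 \<le> R" using R by simp
  qed
  also have "\<dots> = R * N\<^sup>2 * ((1 - (x / N)\<^sup>2) / 2 + 2 * \<eta>)"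
    using N R(1) by (simp add: field_simps power2_eq_square flip: R(1))
  finally show ?thesis unfolding R(1) by (simp add: x_def N_def)
qed

text \<open>\<open>T\<close> is the total deletion cost. With
  \<open>Q = ex3 n F + n\<^sup>2\<close>, the factor \<open>1 + \<epsilon>\<close> gains at least
  \<open>6 * \<eta> * Q\<close>; \<open>T\<close> consumes \<open>2 * \<eta> * Q\<close> of it and
  lower-order terms at most \<open>\<eta> * Q\<close>. The remaining \<open>3 * \<eta> * Q\<close>
  pay for the error in the ratio bound and for \<open>m + 1\<close>.\<close>

lemma many_edges_survive:
  fixes \<epsilon> \<eta> :: real and N1 :: nat
  assumes proper: "turan_proper F" and \<eta>: "0 < \<eta>" "12 * \<eta> \<le> \<epsilon>"
  obtains n0 where "\<And>n m e T. n0 \<le> n \<Longrightarrow> m \<le> n \<Longrightarrow>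
    T \<le> (real (ex3 n F) + (real n)\<^sup>2) * ((1 - (real m / real n)\<^sup>2) / 2 + 2 * \<eta>) \<Longrightarrow>
    (1 + \<epsilon>) * (real (ex3 n F) + real (n choose 2)) - T \<le> real e \<Longrightarrow> e \<le> 2 ^ m \<Longrightarrow>
    N1 \<le> m \<and> ex3 m F + (m choose 2) + m + 1 < e"
proof -
  obtain N where N: "\<And>m n. N \<le> m \<Longrightarrow> m \<le> n \<Longrightarrow> real (ex3 m F) \<le> (real m / real n + \<eta>) * real (ex3 n F)"
    using turan_proper_ratio[OF proper \<eta>(1)] by blast
  define N2 where "N2 = max N N1"
  obtain n1 :: nat where n1: "(2 + \<epsilon> + 2 ^ N2) / \<eta> \<le> real n1" using real_arch_simple by blast
  have choose2: "real (k choose 2) = ((real k)\<^sup>2 - real k) / 2" for k :: nat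
    by (induction k) (auto simp: numeral_2_eq_2 field_simps)
  show ?thesis
  proof (rule that[of "Suc n1"])
    fix n m e :: nat and T :: real
    assume n: "Suc n1 \<le> n" and mn: "m \<le> n"
      and T: "T \<le> (real (ex3 n F) + (real n)\<^sup>2) * ((1 - (real m / real n)\<^sup>2) / 2 + 2 * \<eta>)"
      and e: "(1 + \<epsilon>) * (real (ex3 n F) + real (n choose 2)) - T \<le> real e" and e2: "e \<le> 2 ^ m"
    define E where "E = real (ex3 n F)"
    define Q where "Q = E + (real n)\<^sup>2"
    define x where "x = real m / real n"
    have n_pos: "1 \<le> real n" using n by simp
    have E: "0 \<le> E" by (simp add: E_def)
    have xm: "x\<^sup>2 * (real n)\<^sup>2 = (real m)\<^sup>2" using n_pos by (simp add: x_def power_divide)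
    have "(2 + \<epsilon> + 2 ^ N2) / \<eta> \<le> real n" using n1 n by linarith
    then have \<eta>n: "2 + \<epsilon> + 2 ^ N2 \<le> \<eta> * real n" using \<eta> by (simp add: field_simps)
    have \<eta>n2: "\<eta> * (real n)\<^sup>2 \<le> \<eta> * Q" using \<eta> E by (simp add: Q_def)
    have "(2 + \<epsilon> + 2 ^ N2) * real n \<le> \<eta> * real n * real n" using \<eta>n by (rule mult_right_mono) simp
    then have big: "2 * real n + \<epsilon> * real n + 2 ^ N2 * real n \<le> \<eta> * Q"
      using \<eta>n2 by (simp add: algebra_simps power2_eq_square)
    have \<epsilon>n: "0 \<le> \<epsilon> * real n" using \<eta> by simp
    have N2n: "2 ^ N2 * 1 \<le> 2 ^ N2 * real n" using n_pos by (intro mult_left_mono) auto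
    have c: "0 < \<eta> * Q" using big \<epsilon>n N2n n_pos by (smt (verit) zero_le_power)
    have "12 * \<eta> * (E + (real n)\<^sup>2 / 2) \<le> \<epsilon> * (E + (real n)\<^sup>2 / 2)"
      using \<eta> E by (intro mult_right_mono) auto
    moreover have "6 * (\<eta> * Q) \<le> 12 * \<eta> * (E + (real n)\<^sup>2 / 2)"
      using \<eta> E by (simp add: Q_def algebra_simps)
    ultimately have gain: "6 * (\<eta> * Q) \<le> \<epsilon> * (E + (real n)\<^sup>2 / 2)" by linarith
    have "(1 + \<epsilon>) * (E + real (n choose 2)) = E + (real n)\<^sup>2 / 2 + \<epsilon> * (E + (real n)\<^sup>2 / 2) - (real n + \<epsilon> * real n) / 2"
      by (simp add: choose2 field_simps)
    moreover have "Q * ((1 - x\<^sup>2) / 2 + 2 * \<eta>) = E / 2 - x\<^sup>2 * E / 2 + (real n)\<^sup>2 / 2 - (real m)\<^sup>2 / 2 + 2 * (\<eta> * Q)"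
      unfolding xm[symmetric] by (simp add: Q_def field_simps)
    ultimately have lower: "E / 2 + x\<^sup>2 * E / 2 + (real m)\<^sup>2 / 2 + 3 * (\<eta> * Q) \<le> real e"
      using e T gain big \<epsilon>n N2n n_pos zero_le_power[of "2::real" N2]
      unfolding E_def[symmetric] Q_def[symmetric] x_def[symmetric] by argo
    have x2E: "0 \<le> x\<^sup>2 * E" using E by simp
    \<comment> \<open>At most \<open>2 ^ m\<close> edges fit on \<open>m\<close> vertices, so the
      many survivors rule out small \<open>m\<close>; only then does the ratio bound apply.\<close>
    have m: "N2 \<le> m"
    proof (rule ccontr)
      assume "\<not> N2 \<le> m"
      then have "(2::nat) ^ m \<le> 2 ^ N2" by (intro power_increasing) auto
      then have "real e \<le> 2 ^ N2" using e2 by (metis of_nat_le_iff of_nat_numeral of_nat_power order_trans)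
      then show False using lower x2E E c big \<epsilon>n N2n n_pos zero_le_power2[of "real m"] by argo
    qed
    \<comment> \<open>This is \<open>x \<le> (1 + x\<^sup>2) / 2\<close>, which compares the ratio
      bound with the edge count in \<open>lower\<close>.\<close>
    have "0 \<le> (x - 1)\<^sup>2 * E" using E by simp
    then have "x * E \<le> E / 2 + x\<^sup>2 * E / 2" by (simp add: power2_eq_square algebra_simps)
    moreover have "real (ex3 m F) \<le> x * E + \<eta> * E"
      using N[of m n] m mn by (simp add: N2_def E_def x_def algebra_simps)
    moreover have "\<eta> * E \<le> \<eta> * Q" using \<eta> by (simp add: Q_def)
    moreover have "real (m choose 2) \<le> (real m)\<^sup>2 / 2" by (simp add: choose2)
    moreover have "real m + 1 \<le> \<eta> * Q"
      using big \<epsilon>n N2n n_pos of_nat_mono[OF mn, where 'a=real] zero_le_power[of "2::real" N2] by argo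
    ultimately have "real (ex3 m F) + real (m choose 2) + (real m + 1) < real e"
      using lower c by argo
    then have "ex3 m F + (m choose 2) + m + 1 < e" by linarith
    then show "N1 \<le> m \<and> ex3 m F + (m choose 2) + m + 1 < e" using m by (simp add: N2_def)
  qed
qed

text \<open>The left-hand side equals \<open>exp 3 / (1 + 3 / n) ^ n / n\<^sup>2\<close>, whose
  first quotient tends to \<open>1\<close>.\<close>

lemma eventually_exp_factor_le:
  fixes \<eta> :: real
  assumes "0 < \<eta>"
  shows "\<forall>\<^sub>F n in sequentially.
    exp 1 ^ 3 * real n ^ (n - 2) / (real n + 3) ^ n \<le> (1 + \<eta>) / (real n)\<^sup>2"
proof -
  have "(\<lambda>n. exp 3 / (1 + 3 / real n) ^ n) \<longlonglongrightarrow> exp 3 / exp (3::real)"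
    by (intro tendsto_divide tendsto_const tendsto_exp_limit_sequentially) simp
  then have "\<forall>\<^sub>F n in sequentially. exp 3 / (1 + 3 / real n) ^ n < 1 + \<eta>"
    using assms by (intro order_tendstoD(2)) auto
  then show ?thesis
    \<comment> \<open>The exponent \<open>n - 2\<close> is truncated, so \<open>n \<ge> 2\<close> is
      needed to restore \<open>n ^ n\<close>.\<close>
    using eventually_ge_at_top[of 2]
  proof eventually_elim
    case (elim n)
    have n: "real n > 0" using elim by simp
    have e: "exp 1 ^ 3 = exp (3::real)" using exp_of_nat_mult[of 3 "1::real"] by simp
    have "real n ^ n = real n ^ (n - 2) * (real n)\<^sup>2" 
      using elim by (metis le_add_diff_inverse2 power_add)
    moreover have "1 + 3 / real n = (real n + 3) / real n" using n by (simp add: field_simps)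
    ultimately have "exp 1 ^ 3 * real n ^ (n - 2) / (real n + 3) ^ n
        = exp 3 / (1 + 3 / real n) ^ n / (real n)\<^sup>2"
      using n by (simp add: e power_divide)
    also have "\<dots> \<le> (1 + \<eta>) / (real n)\<^sup>2" using elim by (intro divide_right_mono) auto
    finally show ?case .
  qed
qed

section \<open>Choice of constants, deletion, and extension of the surviving copy of
  \<open>F\<close>\<close>

theorem theorem4p1:
  fixes F :: "'a hypergraph" and A :: "'a set" and \<epsilon> :: real
  assumes "three_graph F" and "turan_proper F" and "A \<subseteq> verts F" and "\<epsilon> > 0"
  shows "\<exists>n0::nat. \<forall>n\<ge>n0. \<forall>H :: 'b hypergraph.
    simplicial_complex H \<longrightarrow> card (verts H) = n \<longrightarrow>
    (exp 1 ^ 3 * real n ^ (n - 2)) / (real n + 3) ^ n * (real (ex3 n F) + real n ^ 2)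
      \<ge> ((real (card A) - 1) / real (card A)
           + 1 / real n * ((real (card (verts F)) - real (card A)) / real (card A)))
        * (1 + (\<Sum>i=2..<n. real (max_pair_degree H (i + 1)) / real i)) \<longrightarrow>
    real (card (edges H)) \<ge> (1 + \<epsilon>) * (real (ex3 n F) + real (n choose 2)) \<longrightarrow>
    (\<forall>e\<in>edges H. card e \<noteq> 4) \<or> contains_copy (complete_three_graph 4) F \<longrightarrow>
    contains_copy H (plus_complex F A)"
proof -
  define a where "a = card A"
  define v where "v = card (verts F)"
  define p where "p = (real a - 1) / real a"
  define q where "q = (real v - real a) / real a"
  \<comment> \<open>The bound \<open>1\<close> serves \<open>threshold_sum_le\<close>, the bound
    \<open>\<epsilon> / 12\<close> serves \<open>many_edges_survive\<close>.\<close>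
  define \<eta> where "\<eta> = min 1 (\<epsilon> / 12)"
  have fF: "finite (verts F)" using assms(1) by (simp add: three_graph_def)
  have av: "a \<le> v" unfolding a_def v_def using assms(3) fF by (rule card_mono[rotated])
  \<comment> \<open>For \<open>a = 0\<close>, division by zero yields \<open>q = 0\<close>.\<close>
  then have q: "0 \<le> q" by (simp add: q_def)
  have \<eta>: "0 < \<eta>" "\<eta> \<le> 1" "12 * \<eta> \<le> \<epsilon>" using assms(4) by (auto simp: \<eta>_def)
  \<comment> \<open>Having \<open>v + 1\<close> vertices leaves one outside the copy, which is all
    that an empty \<open>A\<close> requires.\<close>
  obtain n1 where n1: "\<And>n m e T. n1 \<le> n \<Longrightarrow> m \<le> n \<Longrightarrow>
    T \<le> (real (ex3 n F) + (real n)\<^sup>2) * ((1 - (real m / real n)\<^sup>2) / 2 + 2 * \<eta>) \<Longrightarrow>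
    (1 + \<epsilon>) * (real (ex3 n F) + real (n choose 2)) - T \<le> real e \<Longrightarrow> e \<le> 2 ^ m \<Longrightarrow>
    v + 1 \<le> m \<and> ex3 m F + (m choose 2) + m + 1 < e"
    using many_edges_survive[OF assms(2) \<eta>(1,3), where ?N1.0 = "v + 1"] by metis
  obtain n2 where n2: "\<And>n. n2 \<le> n \<Longrightarrow>
      exp 1 ^ 3 * real n ^ (n - 2) / (real n + 3) ^ n \<le> (1 + \<eta>) / (real n)\<^sup>2"
    using eventually_exp_factor_le[OF \<eta>(1)] by (auto simp: eventually_sequentially)
  \<comment> \<open>The first summand is for \<open>2 \<le> a\<close>, the second for the constant
    threshold \<open>2 ^ v\<close> when \<open>a \<le> 1\<close>.\<close>
  obtain n3 :: nat where n3: "(4 * (2 * q + 1) + 2 ^ v) / \<eta> \<le> real n3" using real_arch_simple by blast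
  show ?thesis
  proof (intro exI[of _ "max n1 (max n2 (Suc n3))"] allI impI)
    fix n and H :: "'b hypergraph"
    let ?E = "real (ex3 n F)"
    let ?K = "1 + (\<Sum>i=2..<n. real (max_pair_degree H (i + 1)) / real i)"
    assume n: "max n1 (max n2 (Suc n3)) \<le> n" and H: "simplicial_complex H" and cH: "card (verts H) = n"
      and cond: "((real (card A) - 1) / real (card A)
           + 1 / real n * ((real (card (verts F)) - real (card A)) / real (card A))) * ?K
        \<le> exp 1 ^ 3 * real n ^ (n - 2) / (real n + 3) ^ n * (?E + real n ^ 2)"
      and eH: "(1 + \<epsilon>) * (?E + real (n choose 2)) \<le> real (card (edges H))"
      and four: "(\<forall>e\<in>edges H. card e \<noteq> 4) \<or> contains_copy (complete_three_graph 4) F"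
    have fV: "finite (verts H)" using H by (simp add: simplicial_complex_def)
    have n_pos: "1 \<le> real n" using n by simp
    have "(4 * (2 * q + 1) + 2 ^ v) / \<eta> \<le> real n" using n3 n by linarith
    then have \<eta>n: "4 * (2 * q + 1) + 2 ^ v \<le> \<eta> * real n" using \<eta> by (simp add: field_simps)
    have K: "1 \<le> ?K" by (simp add: sum_nonneg)
    \<comment> \<open>For \<open>a \<le> 1\<close> the coefficient \<open>p\<close> vanishes and the hypothesis does not control \<open>?K\<close>, but a
      constant number of neighbours suffices.\<close>
    define t where "t j = (if 2 \<le> a then 2 + (p * real j + q) * ?K else 2 ^ v)" for j :: nat
    obtain W where W: "W \<subseteq> verts H"
      and deg: "\<And>x. x \<in> W \<Longrightarrow> t (card W) \<le> real (degree (induced H W) x)"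
      and eW: "real (card (edges H)) - (\<Sum>j\<in>{card W<..n}. t j) \<le> real (card (edges (induced H W)))"
      using exists_induced_min_degree[OF H, of t] cH by metis
    define G where "G = induced H W"
    define m where "m = card W"
    have G: "simplicial_complex G" unfolding G_def using H W by (rule simplicial_complex_induced)
    have VG: "verts G = W" by (simp add: G_def)
    have mn: "m \<le> n" unfolding m_def using card_mono[OF fV W] cH by simp
    have T: "(\<Sum>j\<in>{m<..n}. t j) \<le> (?E + (real n)\<^sup>2) * ((1 - (real m / real n)\<^sup>2) / 2 + 2 * \<eta>)"
    proof (cases "2 \<le> a")
      case True
      have "(\<Sum>j\<in>{m<..n}. 2 + (p * real j + q) * ?K)
          \<le> (?E + (real n)\<^sup>2) * ((1 - (real m / real n)\<^sup>2) / 2 + 2 * \<eta>)"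
      proof (rule threshold_sum_le)
        show "1 / 2 \<le> p" using True by (simp add: p_def field_simps)
        show "0 \<le> ?K" using K by linarith
        show "(p + q / real n) * ?K \<le> exp 1 ^ 3 * real n ^ (n - 2) / (real n + 3) ^ n * (?E + (real n)\<^sup>2)"
          using cond by (simp add: p_def q_def a_def v_def mult.commute)
        have "exp 1 ^ 3 * real n ^ (n - 2) / (real n + 3) ^ n * (?E + (real n)\<^sup>2)
            \<le> (1 + \<eta>) / (real n)\<^sup>2 * (?E + (real n)\<^sup>2)"
          using n n2 by (intro mult_right_mono) auto
        then show "exp 1 ^ 3 * real n ^ (n - 2) / (real n + 3) ^ n * (?E + (real n)\<^sup>2)
            \<le> (1 + \<eta>) * (?E + (real n)\<^sup>2) / (real n)\<^sup>2" by simp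
        show "4 * (2 * q + 1) \<le> \<eta> * real n" using \<eta>n zero_le_power[of "2::real" v] by linarith
      qed (use q \<eta> mn in auto)
      then show ?thesis using True by (simp add: t_def)
    next
      case False
      \<comment> \<open>The constant thresholds add up to at most \<open>\<eta> * n\<^sup>2\<close>,
        so the error term \<open>2 * \<eta>\<close> alone pays for them.\<close>
      have "(\<Sum>j\<in>{m<..n}. t j) = real (n - m) * 2 ^ v" using False by (simp add: t_def)
      also have "\<dots> \<le> real n * (\<eta> * real n)"
        using \<eta>n q by (intro mult_mono) auto
      also have "\<dots> \<le> (?E + (real n)\<^sup>2) * (2 * \<eta>)"
      proof -
        have "0 \<le> ?E * \<eta>" "0 \<le> \<eta> * real n * real n" using \<eta> by auto
        then show ?thesis by (simp add: power2_eq_square algebra_simps)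
      qed
      also have "\<dots> \<le> (?E + (real n)\<^sup>2) * ((1 - (real m / real n)\<^sup>2) / 2 + 2 * \<eta>)"
      proof (rule mult_left_mono)
        have "(real m / real n)\<^sup>2 \<le> 1" using mn n_pos by (intro power_le_one) auto
        then show "2 * \<eta> \<le> (1 - (real m / real n)\<^sup>2) / 2 + 2 * \<eta>" by simp
      qed simp
      finally show ?thesis .
    qed
    have "v + 1 \<le> m \<and> ex3 m F + (m choose 2) + m + 1 < card (edges G)"
    proof (rule n1[OF _ mn T])
      show "card (edges G) \<le> 2 ^ m" using simplicial_complex_card_edges_le[OF G] VG by (simp add: m_def)
    qed (use n eH eW in \<open>auto simp: G_def m_def\<close>)
    then have vm: "v < m" and many: "ex3 m F + (m choose 2) + m + 1 < card (edges G)" by auto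
    have "contains_copy G F"
    proof (rule contains_copy_of_many_edges[OF G])
      show "ex3 (card (verts G)) F + (card (verts G) choose 2) + card (verts G) + 1 < card (edges G)"
        using many VG by (simp add: m_def)
      show "(\<forall>e\<in>edges G. card e \<noteq> 4) \<or> contains_copy (complete_three_graph 4) F"
        using four by (auto simp: G_def)
    qed
    then have "contains_copy G (plus_complex F A)"
    proof (rule contains_plus_complex[OF G assms(3)])
      fix U B assume U: "B \<subseteq> U" "U \<subseteq> verts G" "card U = card (verts F)" "card B = card A"
      have fG: "finite (verts G)" using G by (simp add: simplicial_complex_def)
      then have fB: "finite B" using U by (meson finite_subset)
      show "\<exists>y\<in>verts G - U. \<forall>b\<in>B. y \<in> neighbours G b"
      proof (cases "a = 0")
        case True
        then have "B = {}" using U(4) fB by (simp add: a_def)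
        moreover have "\<not> verts G \<subseteq> U"
          using vm U fG VG card_mono[of U "verts G"] by (auto simp: v_def m_def finite_subset)
        ultimately show ?thesis by auto
      next
        case a: False
        show ?thesis
        proof (rule exists_common_neighbour[OF G U(1,2)])
          show "B \<noteq> {}" using a U(4) by (auto simp: a_def)
          fix x assume x: "x \<in> verts G"
          let ?d = "real (card (neighbours G x))"
          have tx: "t m \<le> real (degree G x)" using deg x VG by (simp add: G_def m_def)
          have "p * real m + q < ?d"
          proof (cases "2 \<le> a")
            case True
            have "real (degree G x) \<le> 1 + ?d * ?K"
            proof (rule degree_le_neighbours[OF G])
              show "card (verts G) \<le> n" using mn VG by (simp add: m_def)
              fix i y assume y: "y \<in> verts G" "y \<noteq> x"
              have "pair_degree G (i + 1) x y \<le> pair_degree H (i + 1) x y"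
                unfolding G_def using H by (rule pair_degree_induced_le)
              also have "\<dots> \<le> max_pair_degree H (i + 1)"
                using H x y W VG by (intro pair_degree_le_max) auto
              finally show "real (pair_degree G (i + 1) x y) \<le> real (max_pair_degree H (i + 1))"
                by simp
            qed
            \<comment> \<open>The threshold carries \<open>2 +\<close> where the degree bound has
              \<open>1 +\<close>; the difference makes the inequality strict.\<close>
            then have "(p * real m + q) * ?K < ?d * ?K" using tx True by (simp add: t_def)
            then show ?thesis using K by (simp add: mult_less_cancel_right)
          next
            case False
            \<comment> \<open>Here \<open>p * m + q\<close> equals \<open>v - 1\<close>, so
              \<open>v\<close> neighbours suffice, and \<open>2 ^ v\<close> edges at
              \<open>x\<close> force that many.\<close>
            then have a1: "a = 1" using a by simp
            have "(2::real) ^ v \<le> real (degree G x)" using tx False by (simp add: t_def)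
            also have "\<dots> \<le> 2 ^ card (neighbours G x)"
              using degree_le_power[OF G, of x] by (metis of_nat_le_iff of_nat_numeral of_nat_power)
            finally have "v \<le> card (neighbours G x)" by simp
            then show ?thesis by (simp add: p_def q_def a1)
          qed
          then show "(real (card B) - 1) / real (card B) * real (card (verts G))
              + (real (card U) - real (card B)) / real (card B) < ?d"
            using U VG by (simp add: p_def q_def a_def v_def m_def)
        qed
      qed
    qed
    then show "contains_copy H (plus_complex F A)"
      unfolding G_def using W by (rule contains_copy_induced)
  qed
qed

end
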